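(* Assume (A1)-(A3) and further assume that $S$ is finite. Then there exists a unique function $W$ in the class $C_b((0,1)\times S)\cap C^1((0,1)\times S)$ satisfying $$\alpha\theta\frac{dW}{d\theta}(\theta,i)=\inf_{u\in U_i}\Bigl[\theta c(i,u)W(\theta,i)+\sum_{j\in S}\lambda_{ij}(u)W(\theta,j)\Bigr]\quad\text{on }(0,1)\times S,$$ with $\lim_{\theta\to0}W(\theta,i)=1$ for each $i\in S$.
   Context: $S$ is a finite (discrete) state space. For each $i\in S$, $U_i$ is a (nonempty) compact metric space of actions; $K=\{(i,u): i\in S,u\in U_i\}$. For $j\ne i$, $\lambda_{ij}:U_i\to[0,\infty)$ are given transition rates, and $\lambda_{ii}(u)=-\sum_{j\ne i}\lambda_{ij}(u)$. Assumptions: (A1) every $\lambda_{ij}$ is continuous; (A2) $\sup_i\sup_{u\in U_i}\{-\lambda_{ii}(u)\}\le M<\infty$; (A3) for each $i$ the sum $\sum_{j\neq i}\lambda_{ij}(u)$ converges uniformly in $u\in U_i$ (so $\lambda_{ii}$ is continuous). The running cost $c:K\to[0,\infty)$ is bounded with $c(i,\cdot)$ continuous for each $i$; $\alpha>0$ is the discount factor. $C_b((0,1)\times S)$ is the space of bounded continuous functions on $(0,1)\times S$; $C^1((0,1)\times S)$ is the set of functions continuously differentiable in the first variable on $(0,1)$ for each $i$. *)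

theory Defs
  imports "HOL-Analysis.Analysis"
begin

text \<open>Functions on \<open>(0,1) \<times> S\<close> are total functions on \<open>real \<times> 's\<close> of which only the
  values on \<open>{0<..<1} \<times> S\<close> are constrained; \<open>S\<close> carries the discrete topology.\<close>

definition Cb_01 :: "'s set \<Rightarrow> (real \<times> 's \<Rightarrow> real) set" where
  "Cb_01 S = {W. continuous_map (prod_topology (top_of_set {0<..<1}) (discrete_topology S))
                    euclideanreal W
               \<and> bounded (W ` ({0<..<1} \<times> S))}"

definition C1_01 :: "'s set \<Rightarrow> (real \<times> 's \<Rightarrow> real) set" where
  "C1_01 S = {W. \<forall>i\<in>S. (\<lambda>\<theta>. W (\<theta>, i)) C1_differentiable_on {0<..<1}}"

text \<open>The infimum is a real (conditionally complete) one. For nonempty compact \<open>U i\<close> and data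
  continuous in the action, it ranges over a nonempty bounded set, so it is the genuine infimum.\<close>

definition HJB_eq ::
  "'s set \<Rightarrow> ('s \<Rightarrow> 'u metric) \<Rightarrow> ('s \<Rightarrow> 's \<Rightarrow> 'u \<Rightarrow> real) \<Rightarrow> ('s \<times> 'u \<Rightarrow> real) \<Rightarrow> real
    \<Rightarrow> (real \<times> 's \<Rightarrow> real) \<Rightarrow> bool" where
  "HJB_eq S U rate c \<alpha> W \<longleftrightarrow>
     (\<forall>\<theta>\<in>{0<..<1}. \<forall>i\<in>S.
        \<alpha> * \<theta> * deriv (\<lambda>t. W (t, i)) \<theta> =
          (INF u\<in>mspace (U i). \<theta> * c (i, u) * W (\<theta>, i) + (\<Sum>j\<in>S. rate i j u * W (\<theta>, j))))"

end

theory Submission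
  imports Defs
begin

text \<open>Uniqueness is a maximum principle: the rates \<open>rate i j\<close> are nonnegative off the diagonal with
  zero row sums, so at a maximum of \<open>V - W\<close> over \<open>S\<close> only the cost term contributes, and
  it is of order \<open>\<theta>\<close>, which cancels the singularity at \<open>0\<close>.

  For existence, add \<open>N W\<close> with \<open>N = \<alpha> (k + 1)\<close> above all exit rates to both sides. The
  right-hand side becomes monotone in \<open>W\<close> and, with the integrating factor \<open>\<theta> ^ k\<close>, the
  equation becomes the fixed point equation
  \<open>W (t, i) = (\<integral>s\<in>{0..t}. s ^ k (inf \<dots> + N W (s, i))) / (\<alpha> t ^ (k + 1))\<close>. Its iterates
  from \<open>1\<close> increase and stay below \<open>exp (C t / \<alpha>)\<close>, where \<open>C\<close> bounds the cost; this
  supersolution also forces the limit \<open>1\<close> at \<open>0\<close>.\<close>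

section \<open>Infima of perturbed families, and products with a discrete space\<close>

lemma cINF_mono_shift:
  fixes f g :: "'a \<Rightarrow> real"
  assumes "A \<noteq> {}" "bdd_below (f ` A)" "\<And>x. x \<in> A \<Longrightarrow> f x \<le> g x + d"
  shows "(INF x\<in>A. f x) \<le> (INF x\<in>A. g x) + d"
proof -
  have "(INF x\<in>A. f x) - d \<le> (INF x\<in>A. g x)"
  proof (rule cINF_greatest[OF assms(1)])
    fix x assume "x \<in> A"
    then show "(INF x\<in>A. f x) - d \<le> g x"
      using cINF_lower[OF assms(2), of x] assms(3)[of x] by linarith
  qed
  then show ?thesis by linarith
qed

lemma cINF_dist_le:
  fixes f g :: "'a \<Rightarrow> real"
  assumes "A \<noteq> {}" "bdd_below (f ` A)" "bdd_below (g ` A)"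
    and "\<And>x. x \<in> A \<Longrightarrow> \<bar>f x - g x\<bar> \<le> d"
  shows "\<bar>(INF x\<in>A. f x) - (INF x\<in>A. g x)\<bar> \<le> d"
proof -
  have le: "f x \<le> g x + d" "g x \<le> f x + d" if "x \<in> A" for x
    using assms(4)[OF that] by linarith+
  show ?thesis
    using cINF_mono_shift[OF assms(1,2) le(1)] cINF_mono_shift[OF assms(1,3) le(2)] by linarith
qed

text \<open>The preimage of an open set splits into slices over the points \<open>i\<close>, and
  each slice is an open box because singletons are open in the discrete factor.\<close>

lemma continuous_map_prod_discrete:
  assumes "\<And>i. i \<in> I \<Longrightarrow> continuous_map X Y (\<lambda>x. f (x, i))"
  shows "continuous_map (prod_topology X (discrete_topology I)) Y f"
  unfolding continuous_map_def
proof (intro conjI allI impI)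
  show "f \<in> topspace (prod_topology X (discrete_topology I)) \<rightarrow> topspace Y"
    using assms by (force simp: continuous_map_def)
  fix V assume V: "openin Y V"
  have "{z \<in> topspace (prod_topology X (discrete_topology I)). f z \<in> V}
      = (\<Union>i\<in>I. {x \<in> topspace X. f (x, i) \<in> V} \<times> {i})"
    by auto
  moreover have "openin (prod_topology X (discrete_topology I)) ({x \<in> topspace X. f (x, i) \<in> V} \<times> {i})"
    if "i \<in> I" for i
    using openin_continuous_map_preimage[OF assms[OF that] V] that
    by (simp add: openin_prod_Times_iff)
  ultimately show "openin (prod_topology X (discrete_topology I))
      {z \<in> topspace (prod_topology X (discrete_topology I)). f z \<in> V}"
    by auto
qed

section \<open>The Hamiltonian of a finite controlled chain\<close>

locale controlled_chain =
  fixes S :: "'s set" and A :: "'s \<Rightarrow> 'u set" and rate :: "'s \<Rightarrow> 's \<Rightarrow> 'u \<Rightarrow> real"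
    and c :: "'s \<times> 'u \<Rightarrow> real" and L C \<alpha> :: real
  assumes finite_S: "finite S"
    and A_nonempty: "i \<in> S \<Longrightarrow> A i \<noteq> {}"
    and rate_nonneg: "\<lbrakk>i \<in> S; j \<in> S; j \<noteq> i; u \<in> A i\<rbrakk> \<Longrightarrow> 0 \<le> rate i j u"
    and rate_sum: "\<lbrakk>i \<in> S; u \<in> A i\<rbrakk> \<Longrightarrow> (\<Sum>j\<in>S. rate i j u) = 0"
    and abs_rate_le: "\<lbrakk>i \<in> S; j \<in> S; u \<in> A i\<rbrakk> \<Longrightarrow> \<bar>rate i j u\<bar> \<le> L"
    and cost_nonneg: "\<lbrakk>i \<in> S; u \<in> A i\<rbrakk> \<Longrightarrow> 0 \<le> c (i, u)"
    and cost_le: "\<lbrakk>i \<in> S; u \<in> A i\<rbrakk> \<Longrightarrow> c (i, u) \<le> C"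
    and C_nonneg: "0 \<le> C"
    and alpha_pos: "0 < \<alpha>"
begin

definition ham_at :: "'s \<Rightarrow> real \<Rightarrow> ('s \<Rightarrow> real) \<Rightarrow> 'u \<Rightarrow> real" where
  "ham_at i t v u = t * c (i, u) * v i + (\<Sum>j\<in>S. rate i j u * v j)"

definition ham :: "'s \<Rightarrow> real \<Rightarrow> ('s \<Rightarrow> real) \<Rightarrow> real" where
  "ham i t v = (INF u\<in>A i. ham_at i t v u)"

text \<open>The difference is linear in \<open>s * v i - t * w i\<close> and the
  \<open>v j - w j\<close>, with coefficients bounded by \<open>C\<close> and \<open>L\<close>. The
  bound does not depend on \<open>u\<close>, so it survives the infimum.\<close>

lemma ham_at_diff_le:
  assumes "i \<in> S" "u \<in> A i"
  shows "\<bar>ham_at i s v u - ham_at i t w u\<bar> \<le> C * \<bar>s * v i - t * w i\<bar> + L * (\<Sum>j\<in>S. \<bar>v j - w j\<bar>)"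
proof -
  have "ham_at i s v u - ham_at i t w u = c (i,u) * (s * v i - t * w i) + (\<Sum>j\<in>S. rate i j u * (v j - w j))"
    by (simp add: ham_at_def algebra_simps sum_subtractf)
  moreover have "\<bar>c (i,u) * (s * v i - t * w i)\<bar> \<le> C * \<bar>s * v i - t * w i\<bar>"
    using cost_nonneg[OF assms] cost_le[OF assms] by (simp add: abs_mult mult_right_mono)
  moreover have "\<bar>\<Sum>j\<in>S. rate i j u * (v j - w j)\<bar> \<le> (\<Sum>j\<in>S. L * \<bar>v j - w j\<bar>)"
    by (rule order.trans[OF sum_abs], rule sum_mono)
      (use abs_rate_le assms in \<open>simp add: abs_mult mult_right_mono\<close>)
  ultimately show ?thesis by (simp add: sum_distrib_left)
qed

text \<open>Comparison with the zero function, where \<open>ham_at\<close> vanishes. This makes the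
  real infimum in \<open>ham\<close> a genuine one.\<close>

lemma ham_at_bdd_below: "i \<in> S \<Longrightarrow> bdd_below (ham_at i t v ` A i)"
proof (rule bdd_belowI2)
  fix u assume "i \<in> S" "u \<in> A i"
  then show "- (C * \<bar>t * v i\<bar> + L * (\<Sum>j\<in>S. \<bar>v j\<bar>)) \<le> ham_at i t v u"
    using ham_at_diff_le[of i u t v 0 "\<lambda>_. 0"] by (simp add: ham_at_def)
qed

lemma ham_diff_le:
  assumes "i \<in> S"
  shows "\<bar>ham i s v - ham i t w\<bar> \<le> C * \<bar>s * v i - t * w i\<bar> + L * (\<Sum>j\<in>S. \<bar>v j - w j\<bar>)"
  unfolding ham_def using assms
  by (intro cINF_dist_le A_nonempty ham_at_bdd_below ham_at_diff_le)

lemma ham_zero: "i \<in> S \<Longrightarrow> ham i t (\<lambda>_. 0) = 0"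
  using A_nonempty by (simp add: ham_def ham_at_def)

text \<open>The Lipschitz estimate gives joint continuity in time and state. An arbitrary filter
  serves both continuity in time and the limit along the iterates.\<close>

lemma tendsto_ham:
  assumes i: "i \<in> S" and x: "(x \<longlongrightarrow> t) F" and w: "\<And>j. j \<in> S \<Longrightarrow> ((\<lambda>y. w y j) \<longlongrightarrow> v j) F"
  shows "((\<lambda>y. ham i (x y) (w y)) \<longlongrightarrow> ham i t v) F"
proof (rule Lim_transform2[OF tendsto_const], rule Lim_null_comparison)
  show "\<forall>\<^sub>F y in F. norm (ham i t v - ham i (x y) (w y))
      \<le> C * \<bar>t * v i - x y * w y i\<bar> + L * (\<Sum>j\<in>S. \<bar>v j - w y j\<bar>)"
    using ham_diff_le[OF i] by simp
  have "((\<lambda>y. C * \<bar>t * v i - x y * w y i\<bar> + L * (\<Sum>j\<in>S. \<bar>v j - w y j\<bar>))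
      \<longlongrightarrow> C * \<bar>t * v i - t * v i\<bar> + L * (\<Sum>j\<in>S. \<bar>v j - v j\<bar>)) F"
    by (intro tendsto_intros x w i)
  then show "((\<lambda>y. C * \<bar>t * v i - x y * w y i\<bar> + L * (\<Sum>j\<in>S. \<bar>v j - w y j\<bar>)) \<longlongrightarrow> 0) F"
    by simp
qed

text \<open>With \<open>N\<close> dominating the exit rates this is monotonicity of the uniformised operator
  (\<open>d = 0\<close>); at an index where \<open>v i = w i + d\<close> the terms in \<open>N\<close> cancel and it is the
  maximum principle.\<close>

lemma ham_le_shift:
  assumes i: "i \<in> S" and t: "0 \<le> t" and d: "0 \<le> d"
    and N: "\<And>u. u \<in> A i \<Longrightarrow> 0 \<le> rate i i u + N"
    and le: "\<And>j. j \<in> S \<Longrightarrow> v j \<le> w j + d"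
  shows "ham i t v + N * v i \<le> ham i t w + N * (w i + d) + t * C * d"
proof -
  have "ham_at i t v u \<le> ham_at i t w u + (N * (w i + d - v i) + t * C * d)" if u: "u \<in> A i" for u
  proof -
    have "0 \<le> (\<Sum>j\<in>S - {i}. rate i j u * (w j + d - v j))"
      using le i u by (intro sum_nonneg mult_nonneg_nonneg rate_nonneg) (auto simp: algebra_simps)
    moreover have "0 \<le> (rate i i u + N) * (w i + d - v i)"
      using N[OF u] le[OF i] by simp
    moreover have "(\<Sum>j\<in>S. rate i j u * (w j + d - v j))
        = rate i i u * (w i + d - v i) + (\<Sum>j\<in>S - {i}. rate i j u * (w j + d - v j))"
      using sum.remove[OF finite_S i] .
    \<comment> \<open>The constant shift \<open>d\<close> is multiplied by the row sum of the rates,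
      which is zero.\<close>
    moreover have "(\<Sum>j\<in>S. rate i j u * (w j + d - v j))
        = (\<Sum>j\<in>S. rate i j u * w j) + (\<Sum>j\<in>S. rate i j u) * d - (\<Sum>j\<in>S. rate i j u * v j)"
      by (simp add: algebra_simps sum.distrib sum_subtractf sum_distrib_left)
    moreover have "t * c (i, u) * v i \<le> t * c (i, u) * (w i + d)"
      using t cost_nonneg[OF i u] le[OF i] by (intro mult_left_mono) auto
    moreover have "t * c (i, u) * d \<le> t * C * d"
      using t cost_le[OF i u] d by (intro mult_right_mono mult_left_mono) auto
    ultimately show ?thesis
      using rate_sum[OF i u] by (simp add: ham_at_def algebra_simps)
  qed
  then have "ham i t v \<le> ham i t w + (N * (w i + d - v i) + t * C * d)"
    unfolding ham_def by (intro cINF_mono_shift A_nonempty ham_at_bdd_below i)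
  then show ?thesis by (simp add: algebra_simps)
qed

lemma rate_ge: "i \<in> S \<Longrightarrow> u \<in> A i \<Longrightarrow> 0 \<le> rate i i u + L"
  using abs_rate_le[of i i u] by linarith

text \<open>Division by \<alpha> t isolates the derivative. Its existence is part of the notion,
  since an equation for \<open>deriv\<close> alone does not give differentiability.\<close>

definition solves :: "(real \<Rightarrow> 's \<Rightarrow> real) \<Rightarrow> bool" where
  "solves X \<longleftrightarrow> (\<forall>i\<in>S. ((\<lambda>t. X t i) \<longlongrightarrow> 1) (at_right 0) \<and>
     (\<forall>t\<in>{0<..<1}. ((\<lambda>t. X t i) has_real_derivative ham i t (X t) / (\<alpha> * t)) (at t)))"

section \<open>Comparison of two solutions\<close>

text \<open>At a positive maximum of \<open>(V - W) exp (- K t)\<close> over \<open>{0..a} \<times> S\<close> the maximum principle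
  gives \<open>(V - W)' \<le> (C / \<alpha>) (V - W)\<close>, so for \<open>K > C / \<alpha>\<close> the derivative there is negative.\<close>

lemma solves_le:
  assumes V: "solves V" and W: "solves W" and k: "k \<in> S" and a: "0 < a" "a < 1"
  shows "V a k \<le> W a k"
proof (rule ccontr)
  assume neg: "\<not> V a k \<le> W a k"
  define K where "K = (C + 1) / \<alpha>"
  \<comment> \<open>The value 0 at time 0 is the limit of \<open>V - W\<close> there, so
    \<open>\<phi> i\<close> is continuous on the closed interval and attains its maximum.\<close>
  define \<phi> where "\<phi> i t = (if t = 0 then 0 else (V t i - W t i) * exp (- K * t))" for i t
  have der: "(\<phi> i has_real_derivative
      ((ham i t (V t) - ham i t (W t)) / (\<alpha> * t) - K * (V t i - W t i)) * exp (- K * t)) (at t)"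
    if "i \<in> S" "0 < t" "t < 1" for i t
  proof -
    have v: "((\<lambda>t. V t i) has_real_derivative ham i t (V t) / (\<alpha> * t)) (at t)"
      and w: "((\<lambda>t. W t i) has_real_derivative ham i t (W t) / (\<alpha> * t)) (at t)"
      using that V W by (auto simp: solves_def)
    have "((\<lambda>t. (V t i - W t i) * exp (- K * t)) has_real_derivative
      ((ham i t (V t) - ham i t (W t)) / (\<alpha> * t) - K * (V t i - W t i)) * exp (- K * t)) (at t)"
      by (rule derivative_eq_intros v w refl)+ (simp add: algebra_simps diff_divide_distrib)
    then show ?thesis
      by (rule has_field_derivative_transform_within_open[where S = "{0<..}"])
        (use that in \<open>auto simp: \<phi>_def\<close>)
  qed
  have cont: "continuous_on {0..a} (\<phi> i)" if i: "i \<in> S" for i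
    unfolding continuous_on_eq_continuous_within
  proof
    fix t assume t: "t \<in> {0..a}"
    show "continuous (at t within {0..a}) (\<phi> i)"
    proof (cases "t = 0")
      case True
      have "((\<lambda>t. (V t i - W t i) * exp (- K * t)) \<longlongrightarrow> (1 - 1) * exp (- K * 0)) (at_right 0)"
        using V W i by (intro tendsto_intros) (auto simp: solves_def)
      then have "(\<phi> i \<longlongrightarrow> (1 - 1) * exp (- K * 0)) (at_right 0)"
        by (rule Lim_transform_eventually) (auto simp: \<phi>_def eventually_at_filter)
      then have "(\<phi> i \<longlongrightarrow> 0) (at_right 0)" by simp
      then show ?thesis
        using True a by (simp add: continuous_within at_within_Icc_at_right \<phi>_def)
    next
      case False
      then have "isCont (\<phi> i) t" using DERIV_isCont[OF der[OF i]] t a by auto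
      then show ?thesis by (rule continuous_at_imp_continuous_at_within)
    qed
  qed
  have "\<exists>s\<in>{0..a}. \<forall>t\<in>{0..a}. \<phi> i t \<le> \<phi> i s" if "i \<in> S" for i
    using continuous_attains_sup[OF compact_Icc _ cont[OF that]] a by auto
  then obtain s where s: "\<And>i. i \<in> S \<Longrightarrow> s i \<in> {0..a}" "\<And>i t. i \<in> S \<Longrightarrow> t \<in> {0..a} \<Longrightarrow> \<phi> i t \<le> \<phi> i (s i)"
    by metis
  have "finite ((\<lambda>j. \<phi> j (s j)) ` S)" "(\<lambda>j. \<phi> j (s j)) ` S \<noteq> {}"
    using finite_S k by auto
  from Max_in[OF this] Max_ge[OF this(1)]
  obtain i where i: "i \<in> S" and "\<And>j. j \<in> S \<Longrightarrow> \<phi> j (s j) \<le> \<phi> i (s i)"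
    by auto
  then have max: "\<phi> j t \<le> \<phi> i (s i)" if "j \<in> S" "t \<in> {0..a}" for j t
    using s(2)[OF that] that by force
  define T where "T = s i"
  define d where "d = V T i - W T i"
  \<comment> \<open>The assumed violation makes the maximum positive, which excludes the singular
    time 0.\<close>
  have "0 < \<phi> k a" using neg a by (simp add: \<phi>_def)
  then have pos: "0 < \<phi> i T" using max[OF k, of a] a unfolding T_def by auto
  then have T: "0 < T" "T \<le> a" using s(1)[OF i] unfolding T_def by (auto simp: \<phi>_def split: if_splits)
  have d: "0 < d" using pos T by (simp add: \<phi>_def d_def zero_less_mult_iff)
  \<comment> \<open>At the common time \<open>T\<close> the exponential factors cancel, so
    maximality over \<open>S\<close> becomes the hypothesis of \<open>ham_le_shift\<close>, with
    equality at \<open>i\<close>.\<close>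
  have "V T j \<le> W T j + d" if "j \<in> S" for j
    using max[OF that, of T] T by (simp add: \<phi>_def d_def flip: T_def)
  then have "ham i T (V T) + L * V T i \<le> ham i T (W T) + L * (W T i + d) + T * C * d"
    using T d by (intro ham_le_shift i rate_ge) auto
  then have "ham i T (V T) - ham i T (W T) \<le> T * C * d" by (simp add: d_def)
  then have "(ham i T (V T) - ham i T (W T)) / (\<alpha> * T) \<le> T * C * d / (\<alpha> * T)"
    using T alpha_pos by (intro divide_right_mono) auto
  also have "\<dots> = C * d / \<alpha>"
    using T by simp
  finally have "(ham i T (V T) - ham i T (W T)) / (\<alpha> * T) \<le> C * d / \<alpha>" .
  moreover have "C * d / \<alpha> < K * d"
    using alpha_pos d by (simp add: K_def field_simps)
  ultimately have "((ham i T (V T) - ham i T (W T)) / (\<alpha> * T) - K * (V T i - W T i)) * exp (- K * T) < 0"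
    by (simp add: d_def mult_less_0_iff)
  \<comment> \<open>\<open>T\<close> may be the right endpoint \<open>a\<close>, so a larger value
    is sought to its left.\<close>
  from DERIV_neg_dec_left[OF der[OF i] this] T a
  obtain e where e: "e > 0" "\<And>h. 0 < h \<Longrightarrow> h < e \<Longrightarrow> \<phi> i T < \<phi> i (T - h)" by auto
  define h where "h = min (e/2) T"
  have "\<phi> i T < \<phi> i (T - h)" "T - h \<in> {0..a}" using e T by (auto simp: h_def)
  then show False using max[OF i, of "T - h"] by (simp add: T_def)
qed

end


section \<open>The uniformised integral operator and bounds on its integrand\<close>

text \<open>\<open>k \<ge> 1\<close> makes the integrand vanish at \<open>0\<close>, so that iterates need only be continuous on
  \<open>{0<..1}\<close>.\<close>

locale uniformised_chain = controlled_chain S A rate c L C \<alpha>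
  for S :: "'s set" and A :: "'s \<Rightarrow> 'u set" and rate :: "'s \<Rightarrow> 's \<Rightarrow> 'u \<Rightarrow> real"
    and c :: "'s \<times> 'u \<Rightarrow> real" and L C \<alpha> :: real +
  fixes k :: nat and N :: real
  assumes k_ge: "1 \<le> k" and N_def: "N = \<alpha> * real (Suc k)" and L_le_N: "L \<le> N"
begin

definition integrand :: "(real \<Rightarrow> 's \<Rightarrow> real) \<Rightarrow> 's \<Rightarrow> real \<Rightarrow> real" where
  "integrand w i s = s ^ k * (ham i s (w s) + N * w s i)"

definition picard :: "(real \<Rightarrow> 's \<Rightarrow> real) \<Rightarrow> real \<Rightarrow> 's \<Rightarrow> real" where
  "picard w t i = integral {0..t} (integrand w i) / (\<alpha> * t ^ Suc k)"

text \<open>The upper barrier solves \<alpha> t w' = t C w, the equation with all costs equal to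
  \<open>C\<close>. The constant 1 is a subsolution because costs are nonnegative.\<close>

definition between :: "(real \<Rightarrow> 's \<Rightarrow> real) \<Rightarrow> bool" where
  "between w \<longleftrightarrow> (\<forall>i\<in>S. \<forall>t\<in>{0<..1}. 1 \<le> w t i \<and> w t i \<le> exp (C / \<alpha> * t))"

definition regular :: "(real \<Rightarrow> 's \<Rightarrow> real) \<Rightarrow> bool" where
  "regular w \<longleftrightarrow> (\<forall>i\<in>S. continuous_on {0<..1} (\<lambda>t. w t i))"

lemma N_pos: "0 < N"
  using alpha_pos by (simp add: N_def)

lemma rate_N: "i \<in> S \<Longrightarrow> u \<in> A i \<Longrightarrow> 0 \<le> rate i i u + N"
  using rate_ge[of i u] L_le_N by linarith

lemma zero_power_k [simp]: "0 ^ k = (0::real)"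
  using k_ge by simp

lemma integrand_zero [simp]: "integrand w i 0 = 0"
  by (simp add: integrand_def)

text \<open>For positive times this is \<open>ham_le_shift\<close> with \<open>d = 0\<close>. At 0
  the power \<open>t ^ k\<close> annihilates both sides, so no ordering is asked for there.\<close>

lemma integrand_mono:
  assumes "i \<in> S" "0 \<le> t" "\<And>j. j \<in> S \<Longrightarrow> 0 < t \<Longrightarrow> v t j \<le> w t j"
  shows "integrand v i t \<le> integrand w i t"
proof (cases "t = 0")
  case False
  have "ham i t (v t) + N * v t i \<le> ham i t (w t) + N * (w t i + 0) + t * C * 0"
    using assms False by (intro ham_le_shift rate_N) auto
  then show ?thesis unfolding integrand_def
    using assms(2) by (intro mult_left_mono) auto
qed simp

text \<open>On the constant 1 the rates sum to zero and only the nonnegative cost remains;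
  monotonicity transfers the bound to \<open>w\<close>.\<close>

lemma integrand_ge:
  assumes w: "between w" and i: "i \<in> S" and t: "t \<in> {0..1}"
  shows "N * t ^ k \<le> integrand w i t"
proof (cases "t = 0")
  case True
  then show ?thesis by simp
next
  case False
  have "0 \<le> ham i t (\<lambda>_. 1)"
    unfolding ham_def using i t
    by (intro cINF_greatest A_nonempty) (auto simp: ham_at_def rate_sum cost_nonneg)
  then have "N * t ^ k \<le> integrand (\<lambda>_ _. 1) i t"
    using t by (simp add: integrand_def algebra_simps)
  also have "\<dots> \<le> integrand w i t"
    using w i t False by (intro integrand_mono) (auto simp: between_def)
  finally show ?thesis .
qed

text \<open>\<open>w\<close> lies below the zero function shifted by
  \<open>d = exp (C / \<alpha> * t)\<close>, and such a shift adds at most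
  \<open>N * d + t * C * d\<close>.\<close>

lemma integrand_le:
  assumes w: "between w" and i: "i \<in> S" and t: "t \<in> {0..1}"
  shows "integrand w i t \<le> t ^ k * (N + C * t) * exp (C / \<alpha> * t)"
proof (cases "t = 0")
  case True
  then show ?thesis by simp
next
  case False
  have "ham i t (w t) + N * w t i
      \<le> ham i t (\<lambda>_. 0) + N * (0 + exp (C / \<alpha> * t)) + t * C * exp (C / \<alpha> * t)"
    using w i t False by (intro ham_le_shift rate_N) (auto simp: between_def)
  also have "\<dots> = (N + C * t) * exp (C / \<alpha> * t)"
    using ham_zero[OF i] by (simp add: algebra_simps)
  finally show ?thesis
    using t by (simp add: integrand_def mult_left_mono mult.assoc)
qed

definition bound :: real where
  "bound = (N + C) * exp (C / \<alpha>)"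

text \<open>Keeping the factor \<open>t ^ k\<close> gives continuity at 0; dropping it afterwards
  gives the constant that dominates all iterates.\<close>

lemma integrand_abs_le:
  assumes w: "between w" and i: "i \<in> S" and t: "t \<in> {0..1}"
  shows "\<bar>integrand w i t\<bar> \<le> t ^ k * bound"
proof -
  have "0 \<le> N * t ^ k" using N_pos t by simp
  then have "0 \<le> integrand w i t" using integrand_ge[OF assms] by linarith
  moreover have "C / \<alpha> * t \<le> C / \<alpha>" "C * t \<le> C"
    using t C_nonneg alpha_pos mult_left_le[of t "C / \<alpha>"] by (auto intro!: mult_left_le)
  then have "t ^ k * ((N + C * t) * exp (C / \<alpha> * t)) \<le> t ^ k * bound"
    unfolding bound_def using t N_pos C_nonneg by (intro mult_left_mono mult_mono) auto
  ultimately show ?thesis using integrand_le[OF assms] by (simp add: mult.assoc)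
qed

lemma integrand_abs_le_bound:
  assumes "between w" "i \<in> S" "t \<in> {0..1}"
  shows "\<bar>integrand w i t\<bar> \<le> bound"
proof -
  have "t ^ k * bound \<le> 1 * bound"
    using assms(3) N_pos C_nonneg
    by (intro mult_right_mono power_le_one) (auto simp: bound_def)
  then show ?thesis using integrand_abs_le[OF assms] by simp
qed

lemma tendsto_integrand:
  assumes "i \<in> S" "(x \<longlongrightarrow> t) F" "\<And>j. j \<in> S \<Longrightarrow> ((\<lambda>y. w y (x y) j) \<longlongrightarrow> v t j) F"
  shows "((\<lambda>y. integrand (w y) i (x y)) \<longlongrightarrow> integrand v i t) F"
  unfolding integrand_def
  by (intro tendsto_intros tendsto_ham assms)

lemma continuous_on_integrand:
  assumes w: "between w" "regular w" and i: "i \<in> S"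
  shows "continuous_on {0..1} (integrand w i)"
  unfolding continuous_on_def
proof
  fix t :: real assume t: "t \<in> {0..1}"
  show "(integrand w i \<longlongrightarrow> integrand w i t) (at t within {0..1})"
  proof (cases "t = 0")
    case True
    \<comment> \<open>The value of \<open>w\<close> at 0 is unconstrained, so the integrand is
      squeezed by the power of \<open>s\<close> instead.\<close>
    have "((\<lambda>s. s ^ k * bound) \<longlongrightarrow> 0 ^ k * bound) (at 0 within {0..1})"
      by (intro tendsto_intros)
    then have lim: "((\<lambda>s. s ^ k * bound) \<longlongrightarrow> 0) (at 0 within {0..1})"
      by simp
    have "(integrand w i \<longlongrightarrow> 0) (at 0 within {0..1})"
      by (rule Lim_null_comparison[OF _ lim])
        (use integrand_abs_le[OF w(1) i] in \<open>auto simp: eventually_at_filter\<close>)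
    then show ?thesis using True by simp
  next
    case False
    have "((\<lambda>s. w s j) \<longlongrightarrow> w t j) (at t within {0..1})" if "j \<in> S" for j
    proof -
      have "((\<lambda>s. w s j) \<longlongrightarrow> w t j) (at t within {0<..1})"
        using w(2) that t False by (auto simp: regular_def continuous_on_def)
      moreover have "at t within {0<..1} = at t within {0..1}"
        by (rule at_within_nhd[of _ "{0<..}"]) (use t False in auto)
      ultimately show ?thesis by simp
    qed
    then show ?thesis
      using tendsto_integrand[of i "\<lambda>s. s" t _ "\<lambda>_. w" w] i by simp
  qed
qed

section \<open>Invariance of the barriers under the integral operator\<close>

lemma has_integral_lower:
  assumes "0 \<le> t"
  shows "((\<lambda>s. N * s ^ k) has_integral \<alpha> * t ^ Suc k) {0..t}"
proof -
  have "((\<lambda>s. \<alpha> * s ^ Suc k) has_real_derivative N * s ^ k) (at s within {0..t})" for s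
    by (rule derivative_eq_intros DERIV_pow refl)+ (simp add: N_def)
  then have "((\<lambda>s. N * s ^ k) has_integral \<alpha> * t ^ Suc k - \<alpha> * 0 ^ Suc k) {0..t}"
    by (intro fundamental_theorem_of_calculus assms)
      (simp flip: has_real_derivative_iff_has_vector_derivative)
  then show ?thesis by simp
qed

text \<open>As for the lower barrier, \<open>N = \<alpha> * real (Suc k)\<close> makes the integrand
  an exact derivative. Dividing by \<open>\<alpha> * t ^ Suc k\<close> returns the barrier
  itself.\<close>

lemma has_integral_upper:
  assumes "0 \<le> t"
  shows "((\<lambda>s. s ^ k * (N + C * s) * exp (C / \<alpha> * s)) has_integral
    \<alpha> * t ^ Suc k * exp (C / \<alpha> * t)) {0..t}"
proof -
  have "((\<lambda>s. \<alpha> * s ^ Suc k * exp (C / \<alpha> * s)) has_real_derivative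
      s ^ k * (N + C * s) * exp (C / \<alpha> * s)) (at s within {0..t})" for s
    by (rule derivative_eq_intros DERIV_pow refl)+
      (use alpha_pos in \<open>simp add: N_def algebra_simps\<close>)
  then have "((\<lambda>s. s ^ k * (N + C * s) * exp (C / \<alpha> * s)) has_integral
    \<alpha> * t ^ Suc k * exp (C / \<alpha> * t) - \<alpha> * 0 ^ Suc k * exp (C / \<alpha> * 0)) {0..t}"
    by (intro fundamental_theorem_of_calculus assms)
      (simp flip: has_real_derivative_iff_has_vector_derivative)
  then show ?thesis by simp
qed

lemma picard_bounds:
  assumes w: "between w" and i: "i \<in> S" and t: "t \<in> {0<..1}"
    and int: "integrand w i integrable_on {0..t}"
  shows "1 \<le> picard w t i" "picard w t i \<le> exp (C / \<alpha> * t)"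
proof -
  have "\<alpha> * t ^ Suc k \<le> integral {0..t} (integrand w i)"
    by (rule has_integral_le[OF has_integral_lower integrable_integral[OF int]])
      (use t integrand_ge[OF w i] in auto)
  moreover have "integral {0..t} (integrand w i) \<le> \<alpha> * t ^ Suc k * exp (C / \<alpha> * t)"
    by (rule has_integral_le[OF integrable_integral[OF int] has_integral_upper])
      (use t integrand_le[OF w i] in auto)
  moreover have "0 < \<alpha> * t ^ Suc k" using alpha_pos t by simp
  ultimately show "1 \<le> picard w t i" "picard w t i \<le> exp (C / \<alpha> * t)"
    unfolding picard_def by (simp_all only: pos_le_divide_eq pos_divide_le_eq mult_1 mult.commute)
qed

lemma continuous_on_picard:
  assumes "integrand w i integrable_on {0..1}"
  shows "continuous_on {0<..1} (\<lambda>t. picard w t i)"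
  unfolding picard_def
  by (intro continuous_intros continuous_on_subset[OF indefinite_integral_continuous_1[OF assms]])
    (use alpha_pos in auto)

section \<open>Monotone iteration and its limit\<close>

definition approx :: "nat \<Rightarrow> real \<Rightarrow> 's \<Rightarrow> real" where
  "approx n = (picard ^^ n) (\<lambda>_ _. 1)"

lemma approx_Suc: "approx (Suc n) = picard (approx n)"
  by (simp add: approx_def)

lemma integrable_integrand:
  assumes "between w" "regular w" "i \<in> S" "t \<in> {0..1}"
  shows "integrand w i integrable_on {0..t}"
  by (intro integrable_continuous_interval continuous_on_subset[OF continuous_on_integrand])
    (use assms in auto)

lemma approx_admissible: "between (approx n) \<and> regular (approx n)"
proof (induction n)
  case 0
  then show ?case
    using alpha_pos C_nonneg by (auto simp: approx_def between_def regular_def)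
next
  case (Suc n)
  then have int: "integrand (approx n) i integrable_on {0..t}" if "i \<in> S" "t \<in> {0..1}" for i t
    using integrable_integrand that by blast
  have "between (approx (Suc n))"
    unfolding between_def approx_Suc using Suc picard_bounds int by auto
  moreover have "regular (approx (Suc n))"
    unfolding regular_def approx_Suc using continuous_on_picard int by auto
  ultimately show ?case by simp
qed

text \<open>The iteration starts at the lower barrier, so its first step goes up; monotonicity of
  the integrand propagates this.\<close>

lemma approx_le_Suc: "i \<in> S \<Longrightarrow> t \<in> {0<..1} \<Longrightarrow> approx n t i \<le> approx (Suc n) t i"
proof (induction n arbitrary: i t)
  case 0
  then show ?case using approx_admissible[of 1] by (auto simp: between_def approx_def)
next
  case (Suc n)
  have "integral {0..t} (integrand (approx n) i) \<le> integral {0..t} (integrand (approx (Suc n)) i)"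
    by (intro integral_le integrable_integrand integrand_mono Suc.IH)
      (use Suc.prems approx_admissible in auto)
  then show ?case
    using Suc.prems alpha_pos by (simp add: approx_Suc picard_def divide_right_mono)
qed

definition limit :: "real \<Rightarrow> 's \<Rightarrow> real" where
  "limit t i = lim (\<lambda>n. approx n t i)"

lemma approx_tendsto:
  assumes i: "i \<in> S" and t: "t \<in> {0<..1}"
  shows "(\<lambda>n. approx n t i) \<longlonglongrightarrow> limit t i"
proof -
  have inc: "incseq (\<lambda>n. approx n t i)"
    using approx_le_Suc[OF assms] by (rule incseq_SucI)
  have "\<forall>n. approx n t i \<le> exp (C / \<alpha> * t)"
    using approx_admissible assms by (auto simp: between_def)
  then have "convergent (\<lambda>n. approx n t i)"
    using incseq_convergent[OF inc] by (meson convergent_def)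
  then show ?thesis unfolding limit_def by (simp add: convergent_LIMSEQ_iff)
qed

lemma between_limit: "between limit"
  unfolding between_def
proof (intro ballI conjI)
  fix i t assume it: "i \<in> S" "t \<in> {0<..1::real}"
  then have b: "\<forall>n. 1 \<le> approx n t i \<and> approx n t i \<le> exp (C / \<alpha> * t)"
    using approx_admissible by (auto simp: between_def)
  show "1 \<le> limit t i" "limit t i \<le> exp (C / \<alpha> * t)"
    using LIMSEQ_le_const[OF approx_tendsto[OF it]] LIMSEQ_le_const2[OF approx_tendsto[OF it]] b
    by blast+
qed

text \<open>Continuity of the limit is not yet available, so dominated convergence supplies
  integrability of its integrand along with the fixed point equation.\<close>

lemma limit_fixed_point:
  assumes i: "i \<in> S" and t: "t \<in> {0<..1}"
  shows "integrand limit i integrable_on {0..t}" "limit t i = picard limit t i"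
proof -
  have conv: "(\<lambda>n. integrand (approx n) i s) \<longlonglongrightarrow> integrand limit i s" if "s \<in> {0..t}" for s
  proof (cases "s = 0")
    case False
    then show ?thesis
      using tendsto_integrand[of i "\<lambda>_. s" s sequentially approx limit] approx_tendsto i t that by simp
  qed simp
  have int: "integrand (approx n) i integrable_on {0..t}" for n
    using integrable_integrand approx_admissible i t by simp
  have le: "norm (integrand (approx n) i s) \<le> bound" if "s \<in> {0..t}" for n s
    using integrand_abs_le_bound approx_admissible i t that by simp
  note dc = dominated_convergence[OF int integrable_const_ivl le conv]
  show "integrand limit i integrable_on {0..t}" by (rule dc)
  have "(\<lambda>n. approx (Suc n) t i) \<longlonglongrightarrow> picard limit t i"
    unfolding approx_Suc picard_def using dc(2) alpha_pos t by (intro tendsto_intros) auto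
  then show "limit t i = picard limit t i"
    using LIMSEQ_unique LIMSEQ_Suc[OF approx_tendsto[OF assms]] by blast
qed

text \<open>A bootstrap: the fixed point equation writes the limit as an indefinite integral divided
  by a nonvanishing power.\<close>

lemma regular_limit: "regular limit"
  unfolding regular_def
proof
  fix i assume i: "i \<in> S"
  have "continuous_on {0<..1} (\<lambda>t. picard limit t i)"
    using continuous_on_picard limit_fixed_point(1)[OF i, of 1] by simp
  then show "continuous_on {0<..1} (\<lambda>t. limit t i)"
    by (rule continuous_on_eq) (simp add: limit_fixed_point(2)[OF i])
qed

lemma solves_limit: "solves limit"
  unfolding solves_def
proof (intro ballI conjI)
  fix i assume i: "i \<in> S"
  have ev: "\<forall>\<^sub>F t in at_right 0. t \<in> {0<..1::real}"
    unfolding eventually_at_right_field by (intro exI[of _ 1]) auto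
  have "((\<lambda>t. exp (C / \<alpha> * t)) \<longlongrightarrow> exp (C / \<alpha> * 0)) (at_right 0)"
    by (intro tendsto_intros)
  then have lim: "((\<lambda>t. exp (C / \<alpha> * t)) \<longlongrightarrow> 1) (at_right 0)" by simp
  show "((\<lambda>t. limit t i) \<longlongrightarrow> 1) (at_right 0)"
    by (rule tendsto_sandwich[OF _ _ tendsto_const lim]; rule eventually_mono[OF ev])
      (use between_limit i in \<open>auto simp: between_def\<close>)
  fix t :: real assume t: "t \<in> {0<..<1}"
  have "((\<lambda>t. integral {0..t} (integrand limit i)) has_real_derivative integrand limit i t)
      (at t within {0..1})"
    using t by (intro integral_has_real_derivative continuous_on_integrand
        between_limit regular_limit i) auto
  \<comment> \<open>\<open>t\<close> is interior, so the one-sided restriction disappears.\<close>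
  then have dY: "((\<lambda>t. integral {0..t} (integrand limit i)) has_real_derivative integrand limit i t) (at t)"
    using t by (simp add: at_within_Icc_at)
  have "((\<lambda>t. picard limit t i) has_real_derivative
      (integrand limit i t * (\<alpha> * t ^ Suc k)
        - integral {0..t} (integrand limit i) * (\<alpha> * (real (Suc k) * t ^ k)))
      / ((\<alpha> * t ^ Suc k) * (\<alpha> * t ^ Suc k))) (at t)"
    unfolding picard_def
    by (rule derivative_eq_intros dY refl)+ (use t alpha_pos in auto)
  \<comment> \<open>The fixed point equation, read backwards, eliminates the integral from the
    quotient rule.\<close>
  moreover have "integral {0..t} (integrand limit i) = limit t i * (\<alpha> * t ^ Suc k)"
    using limit_fixed_point(2)[OF i, of t] t alpha_pos by (simp add: picard_def)
  ultimately have "((\<lambda>t. picard limit t i) has_real_derivative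
      (integrand limit i t * (\<alpha> * t ^ Suc k)
        - limit t i * (\<alpha> * t ^ Suc k) * (\<alpha> * (real (Suc k) * t ^ k)))
      / ((\<alpha> * t ^ Suc k) * (\<alpha> * t ^ Suc k))) (at t)"
    by simp
  \<comment> \<open>The terms in \<open>N\<close> cancel against the derivative of the power, since
    \<open>N = \<alpha> * real (Suc k)\<close>.\<close>
  also have "integrand limit i t * (\<alpha> * t ^ Suc k)
        - limit t i * (\<alpha> * t ^ Suc k) * (\<alpha> * (real (Suc k) * t ^ k))
      = ham i t (limit t) * (t ^ k * (\<alpha> * t ^ Suc k))"
  proof -
    have "p * (h + N * x) * q - x * q * (\<alpha> * (real (Suc k) * p)) = h * (p * q)" for p h x q
      unfolding N_def by (simp only: algebra_simps)
    then show ?thesis by (simp only: integrand_def)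
  qed
  also have "\<dots> / ((\<alpha> * t ^ Suc k) * (\<alpha> * t ^ Suc k)) = ham i t (limit t) / (\<alpha> * t)"
    using t alpha_pos by simp
  finally show "((\<lambda>t. limit t i) has_real_derivative ham i t (limit t) / (\<alpha> * t)) (at t)"
    by (rule has_field_derivative_transform_within_open[where S = "{0<..<1}"])
      (use t i limit_fixed_point(2) in auto)
qed

end

section \<open>Existence and regularity of solutions\<close>

context controlled_chain
begin

lemma ex_solution:
  obtains W B where "solves W" "\<And>i t. i \<in> S \<Longrightarrow> t \<in> {0<..<1} \<Longrightarrow> \<bar>W t i\<bar> \<le> B"
proof -
  obtain n :: nat where n: "L / \<alpha> \<le> real n" using real_arch_simple by blast
  \<comment> \<open>The successor secures \<open>1 \<le> k\<close>; the choice of \<open>n\<close>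
    lets \<open>\<alpha> * real (Suc k)\<close> dominate \<open>L\<close>.\<close>
  define k where "k = Suc n"
  have "L \<le> \<alpha> * real (Suc k)"
    using n alpha_pos by (simp add: k_def field_simps)
  then interpret uniformised_chain S A rate c L C \<alpha> k "\<alpha> * real (Suc k)"
    by unfold_locales (auto simp: k_def)
  have "\<bar>limit t i\<bar> \<le> exp (C / \<alpha>)" if "i \<in> S" "t \<in> {0<..<1}" for i t
  proof -
    have "exp (C / \<alpha> * t) \<le> exp (C / \<alpha>)"
      using that C_nonneg alpha_pos mult_left_le[of t "C / \<alpha>"] by auto
    moreover have "1 \<le> limit t i" "limit t i \<le> exp (C / \<alpha> * t)"
      using between_limit that by (auto simp: between_def)
    ultimately show ?thesis by linarith
  qed
  then show thesis using that solves_limit by blast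
qed

lemma solves_continuous:
  assumes "solves W" "i \<in> S"
  shows "continuous_on {0<..<1} (\<lambda>t. W t i)"
  using assms by (auto simp: solves_def intro!: continuous_at_imp_continuous_on DERIV_isCont)

text \<open>The equation expresses the derivative through \<open>ham\<close>, which is jointly
  continuous.\<close>

lemma solves_C1:
  assumes W: "solves W" and i: "i \<in> S"
  shows "(\<lambda>t. W t i) C1_differentiable_on {0<..<1}"
  unfolding C1_differentiable_on_def
proof (intro exI conjI ballI)
  fix t :: real assume "t \<in> {0<..<1}"
  then show "((\<lambda>t. W t i) has_vector_derivative ham i t (W t) / (\<alpha> * t)) (at t)"
    using W i by (auto simp: solves_def simp flip: has_real_derivative_iff_has_vector_derivative)
next
  have "continuous_on {0<..<1} (\<lambda>t. ham i t (W t))"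
    unfolding continuous_on_def
    using solves_continuous[OF W] i
    by (auto intro!: tendsto_ham tendsto_intros simp: continuous_on_def)
  then show "continuous_on {0<..<1} (\<lambda>t. ham i t (W t) / (\<alpha> * t))"
    using alpha_pos by (intro continuous_intros) auto
qed

end

section \<open>Transfer to the original equation\<close>

theorem theorem3p4:
  fixes S :: "'s set"
    and U :: "'s \<Rightarrow> 'u metric"
    and rate :: "'s \<Rightarrow> 's \<Rightarrow> 'u \<Rightarrow> real"
    and c :: "'s \<times> 'u \<Rightarrow> real"
    and \<alpha> M :: real
  assumes S_finite: "finite S"
    and U_compact: "\<And>i. i \<in> S \<Longrightarrow> compact_space (mtopology_of (U i))"
    and U_nonempty: "\<And>i. i \<in> S \<Longrightarrow> mspace (U i) \<noteq> {}"
    and rate_nonneg: "\<And>i j u. \<lbrakk>i \<in> S; j \<in> S; j \<noteq> i; u \<in> mspace (U i)\<rbrakk> \<Longrightarrow> 0 \<le> rate i j u"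
    and rate_diag: "\<And>i u. \<lbrakk>i \<in> S; u \<in> mspace (U i)\<rbrakk> \<Longrightarrow> rate i i u = - (\<Sum>j\<in>S - {i}. rate i j u)"
    and A1: "\<And>i j. \<lbrakk>i \<in> S; j \<in> S; j \<noteq> i\<rbrakk> \<Longrightarrow>
              continuous_map (mtopology_of (U i)) euclideanreal (rate i j)"
    and A2: "\<And>i u. \<lbrakk>i \<in> S; u \<in> mspace (U i)\<rbrakk> \<Longrightarrow> - rate i i u \<le> M"
    and A3: "\<And>i. i \<in> S \<Longrightarrow>
              uniform_limit (mspace (U i)) (\<lambda>F u. \<Sum>j\<in>F. rate i j u) (\<lambda>u. - rate i i u)
                (finite_subsets_at_top (S - {i}))"
    and c_nonneg: "\<And>i u. \<lbrakk>i \<in> S; u \<in> mspace (U i)\<rbrakk> \<Longrightarrow> 0 \<le> c (i, u)"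
    and c_bounded: "bounded (c ` (SIGMA i:S. mspace (U i)))"
    and c_continuous: "\<And>i. i \<in> S \<Longrightarrow>
              continuous_map (mtopology_of (U i)) euclideanreal (\<lambda>u. c (i, u))"
    and alpha_pos: "\<alpha> > 0"
  shows "\<exists>W \<in> Cb_01 S \<inter> C1_01 S.
           HJB_eq S U rate c \<alpha> W \<and> (\<forall>i\<in>S. ((\<lambda>\<theta>. W (\<theta>, i)) \<longlongrightarrow> 1) (at_right 0)) \<and>
           (\<forall>V \<in> Cb_01 S \<inter> C1_01 S.
              HJB_eq S U rate c \<alpha> V \<and> (\<forall>i\<in>S. ((\<lambda>\<theta>. V (\<theta>, i)) \<longlongrightarrow> 1) (at_right 0)) \<longrightarrow>
              (\<forall>p \<in> {0<..<1} \<times> S. V p = W p))"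
proof -
  obtain B where B: "\<And>x. x \<in> c ` (SIGMA i:S. mspace (U i)) \<Longrightarrow> norm x \<le> B"
    using c_bounded unfolding bounded_iff by blast
  \<comment> \<open>An off-diagonal rate is one nonnegative summand of the exit rate, which is at
    most \<open>M\<close>; the diagonal rate is minus the exit rate.\<close>
  have abs_rate: "\<bar>rate i j u\<bar> \<le> \<bar>M\<bar>" if "i \<in> S" "j \<in> S" "u \<in> mspace (U i)" for i j u
  proof (cases "j = i")
    case True
    have "0 \<le> (\<Sum>l\<in>S - {i}. rate i l u)"
      using rate_nonneg that by (intro sum_nonneg) auto
    then show ?thesis using A2[of i u] rate_diag[of i u] that True by simp
  next
    case False
    have "rate i j u \<le> (\<Sum>l\<in>S - {i}. rate i l u)"
      using rate_nonneg that False S_finite by (intro member_le_sum) auto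
    then show ?thesis using A2[of i u] rate_diag[of i u] rate_nonneg[of i j u] that False by simp
  qed
  \<comment> \<open>The absolute value keeps the cost bound nonnegative even for empty
    \<open>S\<close>, where \<open>B\<close> is arbitrary.\<close>
  interpret controlled_chain S "\<lambda>i. mspace (U i)" rate c "\<bar>M\<bar>" "\<bar>B\<bar>" \<alpha>
  proof
    show "(\<Sum>j\<in>S. rate i j u) = 0" if "i \<in> S" "u \<in> mspace (U i)" for i u
      using sum.remove[OF S_finite, of i "\<lambda>j. rate i j u"] rate_diag that by simp
    show "c (i, u) \<le> \<bar>B\<bar>" if "i \<in> S" "u \<in> mspace (U i)" for i u
      using B[of "c (i, u)"] that by force
  qed (use S_finite U_nonempty rate_nonneg abs_rate c_nonneg alpha_pos in auto)
  have HJB_iff: "HJB_eq S U rate c \<alpha> V \<longleftrightarrow>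
      (\<forall>t\<in>{0<..<1}. \<forall>i\<in>S. \<alpha> * t * deriv (\<lambda>s. V (s, i)) t = ham i t (\<lambda>j. V (t, j)))" for V
    by (simp add: HJB_eq_def ham_def ham_at_def)
  \<comment> \<open>Membership in \<open>C1_01 S\<close> turns the values of \<open>deriv\<close>
    into genuine derivatives.\<close>
  have solves: "solves (\<lambda>t i. V (t, i))"
    if "V \<in> C1_01 S" "HJB_eq S U rate c \<alpha> V" "\<forall>i\<in>S. ((\<lambda>\<theta>. V (\<theta>, i)) \<longlongrightarrow> 1) (at_right 0)" for V
    unfolding solves_def
  proof (intro ballI conjI)
    fix i t assume it: "i \<in> S" "t \<in> {0<..<1::real}"
    then have "(\<lambda>t. V (t, i)) field_differentiable at t"
      using that(1) unfolding C1_01_def C1_differentiable_on_def field_differentiable_def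
      unfolding has_real_derivative_iff_has_vector_derivative by blast
    moreover have "\<alpha> * t * deriv (\<lambda>s. V (s, i)) t = ham i t (\<lambda>j. V (t, j))"
      using that(2) it unfolding HJB_iff by blast
    then have "deriv (\<lambda>s. V (s, i)) t = ham i t (\<lambda>j. V (t, j)) / (\<alpha> * t)"
      using it alpha_pos by (simp add: nonzero_eq_divide_eq mult.commute)
    ultimately show "((\<lambda>t. V (t, i)) has_real_derivative ham i t (\<lambda>j. V (t, j)) / (\<alpha> * t)) (at t)"
      using field_differentiable_derivI by metis
  qed (use that in auto)
  obtain X D where X: "solves X" and D: "\<And>i t. i \<in> S \<Longrightarrow> t \<in> {0<..<1} \<Longrightarrow> \<bar>X t i\<bar> \<le> D"
    using ex_solution by blast
  define W where "W = (\<lambda>(t, i). X t i)"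
  have "W \<in> Cb_01 S"
    unfolding Cb_01_def
  proof (intro CollectI conjI)
    show "continuous_map (prod_topology (top_of_set {0<..<1}) (discrete_topology S)) euclideanreal W"
      using solves_continuous[OF X] by (intro continuous_map_prod_discrete) (simp add: W_def)
    show "bounded (W ` ({0<..<1} \<times> S))"
      unfolding bounded_iff using D by (intro exI[of _ D]) (auto simp: W_def)
  qed
  moreover have "W \<in> C1_01 S"
    using solves_C1[OF X] by (simp add: C1_01_def W_def)
  moreover have "HJB_eq S U rate c \<alpha> W"
    unfolding HJB_iff
  proof (intro ballI)
    fix i t assume it: "i \<in> S" "t \<in> {0<..<1::real}"
    then have "deriv (\<lambda>t. X t i) t = ham i t (X t) / (\<alpha> * t)"
      using X unfolding solves_def by (intro DERIV_imp_deriv) auto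
    then show "\<alpha> * t * deriv (\<lambda>s. W (s, i)) t = ham i t (\<lambda>j. W (t, j))"
      using it alpha_pos by (simp add: W_def)
  qed
  moreover have "\<forall>i\<in>S. ((\<lambda>\<theta>. W (\<theta>, i)) \<longlongrightarrow> 1) (at_right 0)"
    using X by (simp add: W_def solves_def)
  moreover have "V p = W p" if V: "V \<in> C1_01 S" "HJB_eq S U rate c \<alpha> V"
    "\<forall>i\<in>S. ((\<lambda>\<theta>. V (\<theta>, i)) \<longlongrightarrow> 1) (at_right 0)" and p: "p \<in> {0<..<1} \<times> S" for V p
    using solves_le[OF solves[OF V] X] solves_le[OF X solves[OF V]] p
    by (auto simp: W_def intro!: antisym)
  ultimately show ?thesis by blast
qed

end
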